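(* Let $k\ge 2$ and let $H$ be a connected graph. Fix a vertex $v\in V(H)$ such that $\alpha_H(v)\leq\alpha_H(w)$ for all $w\in V(H)$. Then the minimum of $\kappa(G)$ over all trees $\mathcal{T}$ on $k$ vertices and all chains $G$ of $k$ copies of $H$ with respect to $\mathcal{T}$ is attained when $\mathcal{T}$ is a star and, for each bridge $x\sim y\in\mathcal{B}_G$, both $x$ and $y$ are the copies of the vertex $v$ in the respective copies of $H$.
   Context: All graphs are finite, simple and undirected. For a connected graph $H$ with $m_H$ edges, consider the simple random walk on $H$ (from a vertex, move to a uniformly random neighbour), with stationary distribution $\pi_j=\deg_H(j)/(2m_H)$ and mean first passage times $m_{i,j}$ from $i$ to $j$ ($i\neq j$). Kemeny's constant is $\kappa(H)=\sum_{j\neq i}\pi_jm_{i,j}$, which does not depend on the choice of the vertex $i$. The accessibility index of a vertex $v$ in $H$ is $\alpha_H(v)=\sum_{i\neq v}\pi_im_{i,v}$. For a single-vertex graph both are $0$ (empty sums). Chain: let $\mathcal{T}$ be a tree with vertex set $\{1,\dots,k\}$ and $G_1,\dots,G_k$ connected graphs (on disjoint vertex sets). A chain of $G_1,\dots,G_k$ with respect to $\mathcal{T}$ is a graph $G$ obtained from the disjoint union of $G_1,\dots,G_k$ by choosing, for each edge $i\sim j$ of $\mathcal{T}$, some vertex $v_i\in V(G_i)$ and some vertex $v_j\in V(G_j)$ and adding the edge $v_i\sim v_j$ (the choices for different edges of $\mathcal{T}$ are independent; the same vertex may be chosen several times). $\mathcal{B}_G$ is the set of the $k-1$ added edges; each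 is a bridge of $G$. Here every $G_i$ is a copy of $H$. A star on $k$ vertices is a tree having a vertex adjacent to all other vertices. *)

theory Defs
  imports "Graph_Theory.Pair_Digraph" "Graph_Theory.Digraph_Component"
    "HOL-Probability.Probability_Mass_Function"
begin

text \<open>
  A finite simple undirected graph is a \<^locale>\<open>pair_graph\<close>: an undirected edge is a pair of
  opposite arcs. Consequently, \<^const>\<open>out_degree\<close> is the degree and the number of arcs is twice
  the number of edges.
\<close>

definition connected_graph :: "'a pair_pre_digraph \<Rightarrow> bool" where
  "connected_graph G \<longleftrightarrow> pair_graph G \<and> Digraph_Component.connected (with_proj G)"

text \<open>
  \<^const>\<open>Digraph_Component.tree\<close> is not used since it is about directed cycles: in a symmetric
  digraph a pair of opposite arcs is already a \<^const>\<open>pre_digraph.cycle\<close>. The cycles of an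
  undirected simple graph are those of length at least three.
\<close>

definition tree_graph :: "'a pair_pre_digraph \<Rightarrow> bool" where
  "tree_graph T \<longleftrightarrow> connected_graph T \<and>
     \<not> (\<exists>p. pre_digraph.cycle (with_proj T) p \<and> 3 \<le> length p)"

definition star_graph :: "'a pair_pre_digraph \<Rightarrow> bool" where
  "star_graph T \<longleftrightarrow> tree_graph T \<and>
     (\<exists>c\<in>pverts T. \<forall>x\<in>pverts T - {c}. (c, x) \<in> parcs T)"


subsection \<open>Simple random walk, Kemeny's constant, accessibility index\<close>

definition stationary :: "'a pair_pre_digraph \<Rightarrow> 'a \<Rightarrow> real" where
  "stationary G j = real (out_degree (with_proj G) j) / real (card (parcs G))"

text \<open>\<open>random_walk G n i\<close> is the joint law of \<open>[X\<^sub>0, \<dots>, X\<^sub>n]\<close> for the walk with \<open>X\<^sub>0 = i\<close>.\<close>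

primrec random_walk :: "'a pair_pre_digraph \<Rightarrow> nat \<Rightarrow> 'a \<Rightarrow> 'a list pmf" where
  "random_walk G 0 i = return_pmf [i]"
| "random_walk G (Suc n) i =
     bind_pmf (pmf_of_set {x. (i, x) \<in> parcs G}) (\<lambda>x. map_pmf ((#) i) (random_walk G n x))"

text \<open>The probability that the walk from \<open>i\<close> visits \<open>j\<close> for the first time at time \<open>n\<close>.\<close>

definition first_passage_prob :: "'a pair_pre_digraph \<Rightarrow> 'a \<Rightarrow> 'a \<Rightarrow> nat \<Rightarrow> real" where
  "first_passage_prob G i j n =
     measure_pmf.prob (random_walk G n i) {xs. xs ! n = j \<and> (\<forall>l<n. xs ! l \<noteq> j)}"

text \<open>
  The expectation of the first passage time. It is only meant for vertices \<open>i \<noteq> j\<close> of a finite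
  connected graph, where the passage time is almost surely finite and the series converges.
\<close>

definition mean_first_passage :: "'a pair_pre_digraph \<Rightarrow> 'a \<Rightarrow> 'a \<Rightarrow> real" where
  "mean_first_passage G i j = (\<Sum>n. real n * first_passage_prob G i j n)"

text \<open>
  For a connected graph the sum below does not depend on the starting vertex \<open>i\<close>, so the
  choice made by \<open>SOME\<close> is immaterial.
\<close>

definition kemeny :: "'a pair_pre_digraph \<Rightarrow> real" where
  "kemeny G = (let i = (SOME i. i \<in> pverts G)
     in \<Sum>j\<in>pverts G - {i}. stationary G j * mean_first_passage G i j)"

definition accessibility :: "'a pair_pre_digraph \<Rightarrow> 'a \<Rightarrow> real" where
  "accessibility G v = (\<Sum>i\<in>pverts G - {v}. stationary G i * mean_first_passage G i v)"


subsection \<open>Chains\<close>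

text \<open>
  The disjoint union of the graphs \<open>Gs i\<close> tags the vertices with the index \<open>i\<close>. For an edge
  \<open>i \<sim> j\<close> of the tree \<open>T\<close>, the chosen vertices are \<open>c i j\<close> in \<open>Gs i\<close> and \<open>c j i\<close> in \<open>Gs j\<close>;
  values of \<open>c\<close> off the edges of \<open>T\<close> are irrelevant. As \<open>parcs T\<close> is symmetric,
  the definitions below cover both ends and both orientations of each edge.
\<close>

definition chain_choice ::
    "(nat \<Rightarrow> 'a pair_pre_digraph) \<Rightarrow> nat pair_pre_digraph \<Rightarrow> (nat \<Rightarrow> nat \<Rightarrow> 'a) \<Rightarrow> bool" where
  "chain_choice Gs T c \<longleftrightarrow> (\<forall>(i, j)\<in>parcs T. c i j \<in> pverts (Gs i))"

definition chain_bridges ::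
    "nat pair_pre_digraph \<Rightarrow> (nat \<Rightarrow> nat \<Rightarrow> 'a) \<Rightarrow> (nat \<times> 'a) rel" where
  "chain_bridges T c = {((i, c i j), (j, c j i)) | i j. (i, j) \<in> parcs T}"

definition chain_graph ::
    "(nat \<Rightarrow> 'a pair_pre_digraph) \<Rightarrow> nat pair_pre_digraph \<Rightarrow> (nat \<Rightarrow> nat \<Rightarrow> 'a) \<Rightarrow>
     (nat \<times> 'a) pair_pre_digraph" where
  "chain_graph Gs T c =
     \<lparr> pverts = (SIGMA i:pverts T. pverts (Gs i)),
       parcs = {((i, x), (i, y)) | i x y. i \<in> pverts T \<and> (x, y) \<in> parcs (Gs i)} \<union>
         chain_bridges T c \<rparr>"

text \<open>
  \<open>is_chain k Gs G\<close>: for some tree on \<open>{1..k}\<close>, \<open>G\<close> is a chain of \<open>Gs 1, \<dots>, Gs k\<close> with respect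
  to that tree.
\<close>

definition is_chain ::
    "nat \<Rightarrow> (nat \<Rightarrow> 'a pair_pre_digraph) \<Rightarrow> (nat \<times> 'a) pair_pre_digraph \<Rightarrow> bool" where
  "is_chain k Gs G \<longleftrightarrow> (\<exists>T c. tree_graph T \<and> pverts T = {1..k} \<and> chain_choice Gs T c \<and>
     G = chain_graph Gs T c)"

end

theory Submission
  imports Defs
begin

text \<open>
  Write \<open>d\<close> for the degrees and \<open>A\<close> for the number of arcs, and call \<open>r \<ge> 0\<close> a resistance kernel if
  \<open>r x x = 0\<close> and the Laplacian of \<open>r(\<cdot>, y)\<close> is \<open>\<tau> - 2 \<delta>\<^sub>y\<close> with \<open>\<tau>\<close> independent of \<open>y\<close>. The effective
  resistance is one, but so is \<open>2 m\<^sub>x\<^sub>y / A\<close>, which is not symmetric and needs no reciprocity theorem.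
  Every kernel satisfies \<open>2 A \<kappa> = Q := \<Sum> d\<^sub>x d\<^sub>y r(x, y)\<close>, because the Laplacian determines the
  passage times up to a term \<open>\<phi>(x) - \<phi>(y)\<close>, which cancels in the double sum. For the kernel
  \<open>2 m\<^sub>x\<^sub>y / A\<close> the quantity \<open>R(v) := \<Sum> d\<^sub>x (r(x, v) + r(v, x))\<close> is \<open>2 (\<alpha>(v) + \<kappa>)\<close>, so the
  vertices that minimise \<open>\<alpha>\<close> are those that minimise \<open>R\<close>.

  Kernels add up along a bridge \<open>p \<sim> q\<close>, with resistance 1 for the bridge, and then
  \<open>Q = Q\<^sub>1 + Q\<^sub>2 + (A\<^sub>2 + 2) R\<^sub>1(p) + (A\<^sub>1 + 2) R\<^sub>2(q) + 2 (A\<^sub>1 + 1) (A\<^sub>2 + 1)\<close>.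
  If the tree is grown leaf by leaf, lower bounds for \<open>Q\<close> and for all \<open>R(x)\<close> are propagated
  simultaneously. They are attained, at \<open>x\<close> the copy of \<open>v\<close> in the centre, for the star all of
  whose bridges join copies of \<open>v\<close>.
\<close>

section \<open>Laplacians of finite connected symmetric relations\<close>

definition lap :: "'a rel \<Rightarrow> ('a \<Rightarrow> real) \<Rightarrow> 'a \<Rightarrow> real" where
  "lap E u x = (\<Sum>y\<in>E `` {x}. u x - u y)"

definition deg :: "'a rel \<Rightarrow> 'a \<Rightarrow> real" where
  "deg E x = real (card (E `` {x}))"

definition deg_sum :: "'a set \<Rightarrow> 'a rel \<Rightarrow> ('a \<Rightarrow> real) \<Rightarrow> real" where
  "deg_sum V E f = (\<Sum>x\<in>V. deg E x * f x)"

lemma deg_sum_cong: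
  "(\<And>x. x \<in> V \<Longrightarrow> f x = g x) \<Longrightarrow> deg_sum V E f = deg_sum V E g"
  unfolding deg_sum_def by (auto intro: sum.cong)

lemma deg_sum_add: "deg_sum V E (\<lambda>x. f x + g x) = deg_sum V E f + deg_sum V E g"
  unfolding deg_sum_def by (simp add: distrib_left sum.distrib)

lemma deg_sum_diff: "deg_sum V E (\<lambda>x. f x - g x) = deg_sum V E f - deg_sum V E g"
  unfolding deg_sum_def by (simp add: right_diff_distrib sum_subtractf)

lemma deg_sum_cmult: "deg_sum V E (\<lambda>x. c * f x) = c * deg_sum V E f"
  unfolding deg_sum_def by (simp add: sum_distrib_left ac_simps)

lemma lap_diff: "lap E (\<lambda>z. f z - g z) x = lap E f x - lap E g x"
  unfolding lap_def by (simp add: sum_subtractf[symmetric] algebra_simps)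

lemma lap_minus: "lap E (\<lambda>z. - f z) x = - lap E f x"
  unfolding lap_def sum_negf[symmetric] by (rule sum.cong) simp_all

lemma lap_cmult: "lap E (\<lambda>z. c * f z) x = c * lap E f x"
  unfolding lap_def by (simp add: sum_distrib_left algebra_simps)

lemma lap_sum: "lap E (\<lambda>z. \<Sum>j\<in>J. f j z) x = (\<Sum>j\<in>J. lap E (f j) x)"
  unfolding lap_def sum_subtractf[symmetric] by (rule sum.swap)

locale network =
  fixes V :: "'a set" and E :: "'a rel"
  assumes finite_V: "finite V" and V_nonempty: "V \<noteq> {}" and E_subset: "E \<subseteq> V \<times> V"
    and sym_E: "sym E"
    and closed_eq_V: "S \<subseteq> V \<Longrightarrow> S \<noteq> {} \<Longrightarrow> E `` S \<subseteq> S \<Longrightarrow> S = V"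
begin

lemma finite_E: "finite E"
  using finite_V E_subset by (meson finite_SigmaI finite_subset)

lemma Image_subset: "E `` A \<subseteq> V"
  using E_subset by auto

lemma finite_Image: "finite (E `` A)"
  using Image_subset finite_V finite_subset by blast

lemma lap_cong:
  assumes "x \<in> V" "\<And>z. z \<in> V \<Longrightarrow> f z = g z"
  shows "lap E f x = lap E g x"
  unfolding lap_def using assms Image_subset[of "{x}"] by (intro sum.cong) auto

lemma lap_add_const:
  assumes "x \<in> V" "\<And>z. z \<in> V \<Longrightarrow> f z = g z + c"
  shows "lap E f x = lap E g x"
  unfolding lap_def using assms Image_subset[of "{x}"] by (intro sum.cong) auto

lemma E_eq_Sigma: "(SIGMA x:V. E `` {x}) = E"
  using E_subset by auto

lemma deg_sum_one: "deg_sum V E (\<lambda>_. 1) = real (card E)"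
proof -
  have "card (SIGMA x:V. E `` {x}) = (\<Sum>x\<in>V. card (E `` {x}))"
    using finite_V finite_Image by (intro card_SigmaI) auto
  then show ?thesis unfolding E_eq_Sigma deg_sum_def deg_def by simp
qed

lemma deg_sum_const: "deg_sum V E (\<lambda>_. c) = real (card E) * c"
  using deg_sum_cmult[of V E c "\<lambda>_. 1"] deg_sum_one by simp

lemma sum_lap: "(\<Sum>x\<in>V. lap E u x) = 0"
proof -
  have *: "(\<Sum>x\<in>V. \<Sum>y\<in>E `` {x}. f x y) = (\<Sum>(x,y)\<in>E. f x y)" for f :: "'a \<Rightarrow> 'a \<Rightarrow> real"
    using sum.Sigma[of V "\<lambda>x. E `` {x}" f] finite_V finite_Image unfolding E_eq_Sigma by simp
  have "(\<Sum>(x,y)\<in>E. u y) = (\<Sum>(x,y)\<in>E. u x)"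
    by (rule sum.reindex_bij_witness[of _ prod.swap prod.swap])
      (use sym_E in \<open>auto elim: symE\<close>)
  then show ?thesis unfolding lap_def *
    by (simp add: case_prod_unfold sum_subtractf)
qed

lemma harmonic_le:
  assumes "j \<in> V" and harmonic: "\<And>x. x \<in> V \<Longrightarrow> x \<noteq> j \<Longrightarrow> lap E u x = 0" and "x \<in> V"
  shows "u x \<le> u j"
proof (rule ccontr)
  assume "\<not> u x \<le> u j"
  define M where "M = Max (u ` V)"
  define S where "S = {x\<in>V. u x = M}"
  have le: "u y \<le> M" if "y \<in> V" for y
    unfolding M_def using that finite_V by simp
  have "M \<in> u ` V" unfolding M_def using finite_V V_nonempty by simp
  then have "S \<noteq> {}" unfolding S_def by auto
  have "u j < M" using le[OF \<open>x \<in> V\<close>] \<open>\<not> u x \<le> u j\<close> by simp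
  have "E `` S \<subseteq> S"
  proof
    fix y assume "y \<in> E `` S"
    then obtain z where z: "z \<in> S" "(z, y) \<in> E" by auto
    then have "z \<in> V" "z \<noteq> j" "u z = M" using \<open>u j < M\<close> by (auto simp: S_def)
    then have "(\<Sum>y\<in>E `` {z}. M - u y) = 0" using harmonic[of z] by (simp add: lap_def)
    moreover have "\<forall>y\<in>E `` {z}. 0 \<le> M - u y" using le Image_subset by auto
    ultimately have "M - u y = 0"
      using sum_nonneg_eq_0_iff[of "E `` {z}" "\<lambda>y. M - u y"] finite_Image z(2) by auto
    then show "y \<in> S" using z(2) E_subset by (auto simp: S_def)
  qed
  then have "S = V" using \<open>S \<noteq> {}\<close> by (intro closed_eq_V) (auto simp: S_def)
  then show False using \<open>u j < M\<close> \<open>j \<in> V\<close> by (auto simp: S_def)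
qed

lemma harmonic_eq:
  assumes "j \<in> V" "\<And>x. x \<in> V \<Longrightarrow> x \<noteq> j \<Longrightarrow> lap E u x = 0" "x \<in> V"
  shows "u x = u j"
proof (rule antisym)
  show "u x \<le> u j" using assms by (rule harmonic_le)
  have "- u x \<le> - u j"
    using assms(1) _ assms(3) by (rule harmonic_le) (simp add: lap_minus assms(2))
  then show "u j \<le> u x" by simp
qed

lemma Image_nonempty:
  assumes "x \<in> V" "y \<in> V" "x \<noteq> y"
  shows "E `` {x} \<noteq> {}"
proof
  assume "E `` {x} = {}"
  then have "{x} = V" using assms(1) by (intro closed_eq_V) auto
  then show False using assms by auto
qed

lemma deg_pos:
  assumes "x \<in> V" "y \<in> V" "x \<noteq> y"
  shows "deg E x > 0"
  using Image_nonempty[OF assms] finite_Image by (simp add: deg_def card_gt_0_iff)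

lemma card_pos:
  assumes "x \<in> V" "y \<in> V" "x \<noteq> y"
  shows "card E > 0"
  using Image_nonempty[OF assms] finite_E by (auto simp: card_gt_0_iff)

end

definition resistance_kernel :: "'a set \<Rightarrow> 'a rel \<Rightarrow> ('a \<Rightarrow> 'a \<Rightarrow> real) \<Rightarrow> bool" where
  "resistance_kernel V E r \<longleftrightarrow> (\<forall>x\<in>V. r x x = 0) \<and> (\<forall>x\<in>V. \<forall>y\<in>V. 0 \<le> r x y) \<and>
     (\<exists>\<tau>. \<forall>x\<in>V. \<forall>y\<in>V. lap E (\<lambda>z. r z y) x = \<tau> x - (if x = y then 2 else 0))"

definition kernel_total :: "'a set \<Rightarrow> 'a rel \<Rightarrow> ('a \<Rightarrow> 'a \<Rightarrow> real) \<Rightarrow> real" where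
  "kernel_total V E r = deg_sum V E (\<lambda>x. deg_sum V E (\<lambda>y. r x y))"

definition kernel_at :: "'a set \<Rightarrow> 'a rel \<Rightarrow> ('a \<Rightarrow> 'a \<Rightarrow> real) \<Rightarrow> 'a \<Rightarrow> real" where
  "kernel_at V E r p = deg_sum V E (\<lambda>x. r x p + r p x)"

section \<open>Joining two networks by a bridge\<close>

locale bridged =
  G1: network V1 E1 + G2: network V2 E2
  for V1 E1 V2 E2 and p q :: 'a +
  assumes disjoint: "V1 \<inter> V2 = {}" and p: "p \<in> V1" and q: "q \<in> V2"
begin

definition "V = V1 \<union> V2"
definition "E = E1 \<union> E2 \<union> {(p, q), (q, p)}"

lemma swapped: "bridged V2 E2 V1 E1 q p"
  by unfold_locales (use disjoint p q in auto)

lemma V_swapped: "bridged.V V2 V1 = V"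
  unfolding V_def bridged.V_def[OF swapped] by auto

lemma E_swapped: "bridged.E E2 E1 q p = E"
  unfolding E_def bridged.E_def[OF swapped] by auto

lemma Image_E:
  assumes "x \<in> V1"
  shows "E `` {x} = E1 `` {x} \<union> (if x = p then {q} else {})"
  using assms disjoint p q G1.E_subset G2.E_subset unfolding E_def by auto

lemma q_notin: "q \<notin> E1 `` A"
  using disjoint q G1.E_subset by auto

lemma deg_E: "x \<in> V1 \<Longrightarrow> deg E x = deg E1 x + (if x = p then 1 else 0)"
  by (simp add: deg_def Image_E card_insert_disjoint[OF G1.finite_Image q_notin])

lemma lap_E:
  "x \<in> V1 \<Longrightarrow> lap E u x = lap E1 u x + (if x = p then u p - u q else 0)"
  by (simp add: lap_def Image_E sum.insert[OF G1.finite_Image q_notin])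

lemma card_E: "card E = card E1 + card E2 + 2"
proof -
  have "E1 \<inter> E2 = {}" using G1.E_subset G2.E_subset disjoint by auto
  moreover have "(E1 \<union> E2) \<inter> {(p, q), (q, p)} = {}"
    using G1.E_subset G2.E_subset disjoint p q by auto
  moreover have "(p, q) \<noteq> (q, p)" using p q disjoint by auto
  ultimately show ?thesis unfolding E_def
    using G1.finite_E G2.finite_E by (simp add: card_Un_disjoint)
qed

lemma deg_sum_V1: "(\<Sum>x\<in>V1. deg E x * f x) = deg_sum V1 E1 f + f p"
proof -
  have "(\<Sum>x\<in>V1. deg E x * f x) = (\<Sum>x\<in>V1. deg E1 x * f x + (if x = p then f x else 0))"
    by (intro sum.cong) (auto simp: deg_E distrib_right)
  also have "\<dots> = deg_sum V1 E1 f + f p"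
    using p G1.finite_V by (simp add: sum.distrib deg_sum_def)
  finally show ?thesis .
qed

lemma deg_sum_E: "deg_sum V E f = deg_sum V1 E1 f + f p + (deg_sum V2 E2 f + f q)"
proof -
  have "(\<Sum>x\<in>V2. deg E x * f x) = deg_sum V2 E2 f + f q"
    using bridged.deg_sum_V1[OF swapped] unfolding E_swapped .
  moreover have "deg_sum V E f = (\<Sum>x\<in>V1. deg E x * f x) + (\<Sum>x\<in>V2. deg E x * f x)"
    unfolding deg_sum_def V_def
    using G1.finite_V G2.finite_V disjoint by (simp add: sum.union_disjoint)
  ultimately show ?thesis using deg_sum_V1[of f] by simp
qed

lemma network: "network V E"
proof
  show "finite V" "V \<noteq> {}" using G1.finite_V G2.finite_V p by (auto simp: V_def)
  show "E \<subseteq> V \<times> V" using G1.E_subset G2.E_subset p q by (auto simp: E_def V_def)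
  show "sym E" using G1.sym_E G2.sym_E unfolding E_def sym_def by blast
  fix S assume S: "S \<subseteq> V" "S \<noteq> {}" "E `` S \<subseteq> S"
  have 1: "S \<inter> V1 = {} \<or> S \<inter> V1 = V1"
    using G1.closed_eq_V[of "S \<inter> V1"] G1.E_subset S(3) unfolding E_def by blast
  have 2: "S \<inter> V2 = {} \<or> S \<inter> V2 = V2"
    using G2.closed_eq_V[of "S \<inter> V2"] G2.E_subset S(3) unfolding E_def by blast
  have "p \<in> S \<longleftrightarrow> q \<in> S" using S(3) unfolding E_def by blast
  then show "S = V" using 1 2 S(1,2) p q unfolding V_def by blast
qed

definition glued :: "('a \<Rightarrow> 'a \<Rightarrow> real) \<Rightarrow> ('a \<Rightarrow> 'a \<Rightarrow> real) \<Rightarrow> 'a \<Rightarrow> 'a \<Rightarrow> real" where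
  "glued r1 r2 x y =
     (if x \<in> V1 then if y \<in> V1 then r1 x y else r1 x p + 1 + r2 q y
      else if y \<in> V1 then r2 x q + 1 + r1 p y else r2 x y)"

lemma glued_simps:
  "x \<in> V1 \<Longrightarrow> y \<in> V1 \<Longrightarrow> glued r1 r2 x y = r1 x y"
  "x \<in> V1 \<Longrightarrow> y \<in> V2 \<Longrightarrow> glued r1 r2 x y = r1 x p + 1 + r2 q y"
  "x \<in> V2 \<Longrightarrow> y \<in> V1 \<Longrightarrow> glued r1 r2 x y = r2 x q + 1 + r1 p y"
  "x \<in> V2 \<Longrightarrow> y \<in> V2 \<Longrightarrow> glued r1 r2 x y = r2 x y"
  using disjoint by (auto simp: glued_def)

lemma glued_swapped:
  "x \<in> V \<Longrightarrow> y \<in> V \<Longrightarrow> bridged.glued V2 q p r2 r1 x y = glued r1 r2 x y"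
  using disjoint unfolding bridged.glued_def[OF swapped] glued_def V_def by auto

lemma lap_glued:
  assumes r1: "resistance_kernel V1 E1 r1" and r2: "resistance_kernel V2 E2 r2"
    and \<tau>1: "\<And>x y. x \<in> V1 \<Longrightarrow> y \<in> V1 \<Longrightarrow>
      lap E1 (\<lambda>z. r1 z y) x = \<tau>1 x - (if x = y then 2 else 0)"
    and x: "x \<in> V1" and y: "y \<in> V"
  shows "lap E (\<lambda>z. glued r1 r2 z y) x
    = \<tau>1 x - (if x = p then 1 else 0) - (if x = y then 2 else 0)"
proof (cases "y \<in> V1")
  case True
  have "lap E1 (\<lambda>z. glued r1 r2 z y) x = lap E1 (\<lambda>z. r1 z y) x"
    using x True by (intro G1.lap_cong) (auto simp: glued_simps)
  moreover have "r2 q q = 0" using r2 q by (simp add: resistance_kernel_def)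
  ultimately show ?thesis using True x p q \<tau>1[of x y] by (simp add: lap_E glued_simps)
next
  case False
  then have y2: "y \<in> V2" using y by (simp add: V_def)
  have "lap E1 (\<lambda>z. glued r1 r2 z y) x = lap E1 (\<lambda>z. r1 z p) x"
    using x y2 by (intro G1.lap_add_const[where c = "1 + r2 q y"]) (auto simp: glued_simps)
  moreover have "r1 p p = 0" using r1 p by (simp add: resistance_kernel_def)
  moreover have "x \<noteq> y" using x False by auto
  ultimately show ?thesis using x y2 p q \<tau>1[of x p] by (simp add: lap_E glued_simps)
qed

lemma resistance_kernel_glued:
  assumes r1: "resistance_kernel V1 E1 r1" and r2: "resistance_kernel V2 E2 r2"
  shows "resistance_kernel V E (glued r1 r2)"
proof -
  interpret G: network V E by (rule network)
  obtain \<tau>1 where \<tau>1: "\<And>x y. x \<in> V1 \<Longrightarrow> y \<in> V1 \<Longrightarrow>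
      lap E1 (\<lambda>z. r1 z y) x = \<tau>1 x - (if x = y then 2 else 0)"
    using r1 unfolding resistance_kernel_def by blast
  obtain \<tau>2 where \<tau>2: "\<And>x y. x \<in> V2 \<Longrightarrow> y \<in> V2 \<Longrightarrow>
      lap E2 (\<lambda>z. r2 z y) x = \<tau>2 x - (if x = y then 2 else 0)"
    using r2 unfolding resistance_kernel_def by blast
  have 1: "lap E (\<lambda>z. glued r1 r2 z y) x
      = \<tau>1 x - (if x = p then 1 else 0) - (if x = y then 2 else 0)" if "x \<in> V1" "y \<in> V" for x y
    using lap_glued[OF r1 r2 \<tau>1 that] .
  have 2: "lap E (\<lambda>z. glued r1 r2 z y) x
      = \<tau>2 x - (if x = q then 1 else 0) - (if x = y then 2 else 0)" if "x \<in> V2" "y \<in> V" for x y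
  proof -
    have "lap E (\<lambda>z. glued r1 r2 z y) x = lap E (\<lambda>z. bridged.glued V2 q p r2 r1 z y) x"
      using that by (intro G.lap_cong) (auto simp: V_def glued_swapped[unfolded V_def])
    then show ?thesis
      using bridged.lap_glued[OF swapped r2 r1 \<tau>2 that(1)] that(2)
      unfolding E_swapped V_swapped by simp
  qed
  have "\<exists>\<tau>. \<forall>x\<in>V. \<forall>y\<in>V.
      lap E (\<lambda>z. glued r1 r2 z y) x = \<tau> x - (if x = y then 2 else 0)"
    by (intro exI[of _ "\<lambda>x. if x \<in> V1 then \<tau>1 x - (if x = p then 1 else 0)
          else \<tau>2 x - (if x = q then 1 else 0)"] ballI)
      (use 1 2 disjoint in \<open>auto simp: V_def\<close>)
  moreover have "\<forall>x\<in>V. glued r1 r2 x x = 0"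
    using r1 r2 unfolding resistance_kernel_def V_def by (auto simp: glued_simps)
  moreover have "\<forall>x\<in>V. \<forall>y\<in>V. 0 \<le> glued r1 r2 x y"
    using r1 r2 p q unfolding resistance_kernel_def V_def by (auto simp: glued_simps)
  ultimately show ?thesis unfolding resistance_kernel_def by blast
qed

lemma kernel_at_glued:
  assumes r1: "resistance_kernel V1 E1 r1" and r2: "resistance_kernel V2 E2 r2" and x: "x \<in> V1"
  shows "kernel_at V E (glued r1 r2) x = kernel_at V1 E1 r1 x
    + (real (card E2) + 2) * (r1 x p + r1 p x) + 2 * (real (card E2) + 1) + kernel_at V2 E2 r2 q"
proof -
  define c where "c = r1 x p + r1 p x + 2"
  have qq: "r2 q q = 0" using r2 q by (simp add: resistance_kernel_def)
  have 1: "deg_sum V1 E1 (\<lambda>z. glued r1 r2 z x + glued r1 r2 x z) = kernel_at V1 E1 r1 x"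
    unfolding kernel_at_def using x by (intro deg_sum_cong) (auto simp: glued_simps)
  have "deg_sum V2 E2 (\<lambda>z. glued r1 r2 z x + glued r1 r2 x z)
      = deg_sum V2 E2 (\<lambda>z. (r2 z q + r2 q z) + c)"
    using x by (intro deg_sum_cong) (auto simp: glued_simps c_def)
  then have 2: "deg_sum V2 E2 (\<lambda>z. glued r1 r2 z x + glued r1 r2 x z)
      = kernel_at V2 E2 r2 q + real (card E2) * c"
    unfolding deg_sum_add G2.deg_sum_const kernel_at_def by simp
  show ?thesis
    unfolding kernel_at_def[of V E] deg_sum_E 1 2
    using x p q by (simp add: glued_simps qq c_def algebra_simps)
qed

lemma kernel_at_glued':
  assumes r1: "resistance_kernel V1 E1 r1" and r2: "resistance_kernel V2 E2 r2" and x: "x \<in> V2"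
  shows "kernel_at V E (glued r1 r2) x = kernel_at V2 E2 r2 x
    + (real (card E1) + 2) * (r2 x q + r2 q x) + 2 * (real (card E1) + 1) + kernel_at V1 E1 r1 p"
proof -
  have "kernel_at V E (bridged.glued V2 q p r2 r1) x = kernel_at V E (glued r1 r2) x"
    unfolding kernel_at_def using x
    by (intro deg_sum_cong arg_cong2[where f = "(+)"] glued_swapped) (simp_all add: V_def)
  then show ?thesis
    using bridged.kernel_at_glued[OF swapped r2 r1 x] unfolding E_swapped V_swapped by simp
qed

lemma deg_sum_deg_sum_glued:
  assumes r1: "resistance_kernel V1 E1 r1" and r2: "resistance_kernel V2 E2 r2"
  shows "deg_sum V1 E1 (\<lambda>x. deg_sum V E (glued r1 r2 x)) + deg_sum V E (glued r1 r2 p)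
    = kernel_total V1 E1 r1 + kernel_at V1 E1 r1 p
      + (real (card E2) + 1) * deg_sum V1 E1 (\<lambda>x. r1 x p)
      + (real (card E1) + 1) * (deg_sum V2 E2 (r2 q) + real (card E2) + 1)"
proof -
  have qq: "r2 q q = 0" and pp: "r1 p p = 0"
    using r1 r2 p q by (simp_all add: resistance_kernel_def)
  have inner: "deg_sum V E (glued r1 r2 x) = deg_sum V1 E1 (r1 x)
      + (real (card E2) + 2) * r1 x p + (deg_sum V2 E2 (r2 q) + real (card E2) + 1)"
    if x: "x \<in> V1" for x
  proof -
    have 1: "deg_sum V1 E1 (glued r1 r2 x) = deg_sum V1 E1 (r1 x)"
      using x by (intro deg_sum_cong) (auto simp: glued_simps)
    have "deg_sum V2 E2 (glued r1 r2 x) = deg_sum V2 E2 (\<lambda>y. r2 q y + (r1 x p + 1))"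
      using x by (intro deg_sum_cong) (auto simp: glued_simps)
    then have 2: "deg_sum V2 E2 (glued r1 r2 x)
        = deg_sum V2 E2 (r2 q) + real (card E2) * (r1 x p + 1)"
      by (simp add: deg_sum_add G2.deg_sum_const distrib_left)
    show ?thesis unfolding deg_sum_E 1 2
      using x p q by (simp add: glued_simps qq algebra_simps)
  qed
  have "deg_sum V1 E1 (\<lambda>x. deg_sum V E (glued r1 r2 x)) = deg_sum V1 E1 (\<lambda>x. deg_sum V1 E1 (r1 x)
      + (real (card E2) + 2) * r1 x p + (deg_sum V2 E2 (r2 q) + real (card E2) + 1))"
    by (intro deg_sum_cong inner)
  then show ?thesis
    unfolding inner[OF p] unfolding deg_sum_add deg_sum_cmult G1.deg_sum_const kernel_total_def kernel_at_def
    by (simp add: pp algebra_simps)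
qed

lemma kernel_total_glued:
  assumes r1: "resistance_kernel V1 E1 r1" and r2: "resistance_kernel V2 E2 r2"
  shows "kernel_total V E (glued r1 r2) = kernel_total V1 E1 r1 + kernel_total V2 E2 r2
    + (real (card E2) + 2) * kernel_at V1 E1 r1 p + (real (card E1) + 2) * kernel_at V2 E2 r2 q
    + 2 * (real (card E1) + 1) * (real (card E2) + 1)"
proof -
  interpret G: network V E by (rule network)
  have sw: "deg_sum V E (bridged.glued V2 q p r2 r1 x) = deg_sum V E (glued r1 r2 x)"
    if "x \<in> V" for x
    using that by (intro deg_sum_cong glued_swapped)
  have "deg_sum V2 E2 (\<lambda>x. deg_sum V E (bridged.glued V2 q p r2 r1 x))
      = deg_sum V2 E2 (\<lambda>x. deg_sum V E (glued r1 r2 x))"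
    by (intro deg_sum_cong sw) (simp add: V_def)
  then have 2: "deg_sum V2 E2 (\<lambda>x. deg_sum V E (glued r1 r2 x)) + deg_sum V E (glued r1 r2 q)
    = kernel_total V2 E2 r2 + kernel_at V2 E2 r2 q
      + (real (card E1) + 1) * deg_sum V2 E2 (\<lambda>x. r2 x q)
      + (real (card E2) + 1) * (deg_sum V1 E1 (r1 p) + real (card E1) + 1)"
    using bridged.deg_sum_deg_sum_glued[OF swapped r2 r1] sw[of q] q
    unfolding V_swapped E_swapped by (simp add: V_def)
  show ?thesis
    unfolding kernel_total_def[of V E] deg_sum_E[of "\<lambda>x. deg_sum V E (glued r1 r2 x)"]
    unfolding 2 deg_sum_deg_sum_glued[OF r1 r2]
    unfolding kernel_at_def deg_sum_add by (simp add: algebra_simps)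
qed

end

section \<open>First passage times of the random walk\<close>

lemma measure_bind_pmf_of_set:
  assumes "finite A" "A \<noteq> {}"
  shows "measure_pmf.prob (bind_pmf (pmf_of_set A) f) B
    = (\<Sum>x\<in>A. measure_pmf.prob (f x) B) / real (card A)"
proof -
  have "ennreal (measure_pmf.prob (bind_pmf (pmf_of_set A) f) B)
      = (\<Sum>x\<in>A. emeasure (f x) B) / real (card A)"
    using assms by (simp add: measure_pmf.emeasure_eq_measure[symmetric] nn_integral_pmf_of_set
        ennreal_of_nat_eq_real_of_nat)
  also have "(\<Sum>x\<in>A. emeasure (f x) B) = ennreal (\<Sum>x\<in>A. measure_pmf.prob (f x) B)"
    by (simp add: measure_pmf.emeasure_eq_measure sum_ennreal)
  also have "\<dots> / real (card A) = ennreal ((\<Sum>x\<in>A. measure_pmf.prob (f x) B) / real (card A))"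
    using assms by (intro divide_ennreal) (auto simp: sum_nonneg card_gt_0_iff)
  finally show ?thesis by (simp add: sum_nonneg)
qed

lemma first_passage_prob_0: "first_passage_prob G i j 0 = (if i = j then 1 else 0)"
  by (simp add: first_passage_prob_def)

lemma first_passage_prob_nonneg: "0 \<le> first_passage_prob G i j n"
  by (simp add: first_passage_prob_def)

locale walk = network "pverts G" "parcs G" for G :: "'a pair_pre_digraph"
begin

abbreviation "V \<equiv> pverts G"
abbreviation "E \<equiv> parcs G"

lemma first_passage_prob_Suc:
  assumes "i \<in> V" "j \<in> V"
  shows "first_passage_prob G i j (Suc n) =
    (if i = j then 0 else (\<Sum>x\<in>E `` {i}. first_passage_prob G x j n) / deg E i)"
proof (cases "i = j")
  case True
  have "random_walk G (Suc n) i = map_pmf ((#) i)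
      (bind_pmf (pmf_of_set {x. (i, x) \<in> E}) (random_walk G n))"
    by (simp add: map_bind_pmf)
  then have "first_passage_prob G i j (Suc n) = measure_pmf.prob
      (bind_pmf (pmf_of_set {x. (i, x) \<in> E}) (random_walk G n))
      ((#) i -` {xs. xs ! Suc n = j \<and> (\<forall>l<Suc n. xs ! l \<noteq> j)})"
    unfolding first_passage_prob_def by (simp only: measure_map_pmf)
  also have "(#) i -` {xs. xs ! Suc n = j \<and> (\<forall>l<Suc n. xs ! l \<noteq> j)} = {}"
    using True by (auto simp: All_less_Suc2)
  finally show ?thesis using True by simp
next
  case False
  have "{x. (i, x) \<in> E} = E `` {i}" by auto
  moreover have "(#) i -` {xs. xs ! Suc n = j \<and> (\<forall>l<Suc n. xs ! l \<noteq> j)}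
      = {xs. xs ! n = j \<and> (\<forall>l<n. xs ! l \<noteq> j)}"
    using False by (auto simp: All_less_Suc2)
  ultimately show ?thesis
    using False Image_nonempty[OF assms False] finite_Image[of "{i}"]
    by (simp add: first_passage_prob_def measure_bind_pmf_of_set deg_def)
qed

definition survival :: "'a \<Rightarrow> nat \<Rightarrow> 'a \<Rightarrow> real" where
  "survival j n i = 1 - (\<Sum>l\<le>n. first_passage_prob G i j l)"

lemma survival_0: "survival j 0 i = (if i = j then 0 else 1)"
  by (simp add: survival_def first_passage_prob_0)

lemma survival_Suc_diff: "survival j (Suc n) i = survival j n i - first_passage_prob G i j (Suc n)"
  by (simp add: survival_def)

lemma survival_self: "j \<in> V \<Longrightarrow> survival j n j = 0"
  by (induction n) (simp_all add: survival_0 survival_Suc_diff first_passage_prob_Suc)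

lemma survival_Suc:
  assumes "i \<in> V" "j \<in> V" "i \<noteq> j"
  shows "deg E i * survival j (Suc n) i = (\<Sum>x\<in>E `` {i}. survival j n x)"
proof -
  have "(\<Sum>l\<le>Suc n. first_passage_prob G i j l) = (\<Sum>l\<le>n. first_passage_prob G i j (Suc l))"
    using assms(3) by (simp only: sum.atMost_Suc_shift first_passage_prob_0) simp
  also have "\<dots> = (\<Sum>l\<le>n. \<Sum>x\<in>E `` {i}. first_passage_prob G x j l) / deg E i"
    using assms by (simp add: first_passage_prob_Suc sum_divide_distrib)
  also have "\<dots> = (\<Sum>x\<in>E `` {i}. \<Sum>l\<le>n. first_passage_prob G x j l) / deg E i"
    by (simp only: sum.swap[of _ "E `` {i}"])
  finally show ?thesis using deg_pos[OF assms]
    by (simp add: survival_def sum_subtractf deg_def field_simps)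
qed

lemma survival_nonneg: "i \<in> V \<Longrightarrow> j \<in> V \<Longrightarrow> 0 \<le> survival j n i"
proof (induction n arbitrary: i)
  case 0
  then show ?case by (simp add: survival_0)
next
  case (Suc n)
  show ?case
  proof (cases "i = j")
    case True
    then show ?thesis using Suc.prems by (simp add: survival_self)
  next
    case False
    have "0 \<le> (\<Sum>x\<in>E `` {i}. survival j n x)"
      using Suc.IH Suc.prems(2) Image_subset by (intro sum_nonneg) blast
    then show ?thesis
      using survival_Suc[OF Suc.prems False] deg_pos[OF Suc.prems False]
      by (metis zero_le_mult_iff not_le)
  qed
qed

lemma decseq_survival: "decseq (\<lambda>n. survival j n i)"
  by (intro decseq_SucI) (simp add: survival_Suc_diff first_passage_prob_nonneg)

lemma survival_le_1: "survival j n i \<le> 1"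
  by (simp add: survival_def sum_nonneg first_passage_prob_nonneg)

lemma survival_tendsto_0:
  assumes "i \<in> V" and j: "j \<in> V"
  shows "(\<lambda>n. survival j n i) \<longlonglongrightarrow> 0"
proof -
  define u where "u i = lim (\<lambda>n. survival j n i)" for i
  have lim: "(\<lambda>n. survival j n i) \<longlonglongrightarrow> u i" if i: "i \<in> V" for i
  proof -
    obtain L where "(\<lambda>n. survival j n i) \<longlonglongrightarrow> L"
      using decseq_convergent[OF decseq_survival, of 0 j i] survival_nonneg[OF i j] by metis
    then show ?thesis unfolding u_def by (simp add: limI)
  qed
  have "lap E u i = 0" if i: "i \<in> V" "i \<noteq> j" for i
  proof -
    have "(\<lambda>n. \<Sum>x\<in>E `` {i}. survival j n x) \<longlonglongrightarrow> (\<Sum>x\<in>E `` {i}. u x)"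
      using lim Image_subset by (intro tendsto_sum) blast
    moreover have "(\<lambda>n. \<Sum>x\<in>E `` {i}. survival j n x) \<longlonglongrightarrow> deg E i * u i"
      using tendsto_mult[OF tendsto_const LIMSEQ_Suc[OF lim[OF i(1)]], of "deg E i"]
      unfolding survival_Suc[OF i(1) j i(2)] .
    ultimately show ?thesis
      using LIMSEQ_unique by (fastforce simp: lap_def sum_subtractf deg_def)
  qed
  then have "u i = u j" using assms by (intro harmonic_eq)
  moreover have "u j = 0" using j by (simp add: u_def survival_self)
  ultimately show ?thesis using lim[OF assms(1)] by simp
qed

lemma first_passage_prob_sums:
  assumes "i \<in> V" "j \<in> V"
  shows "first_passage_prob G i j sums 1"
proof -
  have "(\<lambda>n. 1 - survival j n i) \<longlonglongrightarrow> 1 - 0"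
    using survival_tendsto_0[OF assms] by (intro tendsto_intros)
  then show ?thesis unfolding sums_def_le by (simp add: survival_def)
qed

lemma sum_survival_bounded:
  assumes j: "j \<in> V"
  shows "\<exists>C. \<forall>i\<in>V. \<forall>K. (\<Sum>n<K. survival j n i) \<le> C"
proof -
  have "\<forall>\<^sub>F n in sequentially. \<forall>i\<in>V. survival j n i < 1 / 2"
    using survival_tendsto_0 j finite_V
    by (intro eventually_ball_finite ballI order_tendstoD(2)) auto
  then obtain N where N: "\<And>i. i \<in> V \<Longrightarrow> survival j N i < 1 / 2"
    unfolding eventually_sequentially by blast
  have half: "survival j (n + N) i \<le> survival j n i / 2" if "i \<in> V" for n i
    using that
  proof (induction n arbitrary: i)
    case 0
    then show ?case using N[of i] j by (cases "i = j") (auto simp: survival_0 survival_self)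
  next
    case (Suc n)
    show ?case
    proof (cases "i = j")
      case True
      then show ?thesis using j by (simp add: survival_self)
    next
      case False
      have "deg E i * survival j (Suc n + N) i = (\<Sum>x\<in>E `` {i}. survival j (n + N) x)"
        using survival_Suc[OF Suc.prems j False] by simp
      also have "\<dots> \<le> (\<Sum>x\<in>E `` {i}. survival j n x / 2)"
        using Suc.IH Image_subset by (intro sum_mono) blast
      also have "\<dots> = deg E i * (survival j (Suc n) i / 2)"
        using survival_Suc[OF Suc.prems j False, of n] by (simp add: sum_divide_distrib[symmetric])
      finally show ?thesis using deg_pos[OF Suc.prems j False] by (simp only: mult_le_cancel_left_pos)
    qed
  qed
  have "(\<Sum>n<K. survival j n i) \<le> 2 * real N" if i: "i \<in> V" for i K
  proof -
    have "(\<Sum>n<K. survival j n i) \<le> (\<Sum>n<K + N. survival j n i)"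
      using survival_nonneg[OF i j] by (intro sum_mono2) auto
    also have "\<dots> = (\<Sum>n<N. survival j n i) + (\<Sum>n<K. survival j (n + N) i)"
      by (induction K) auto
    also have "(\<Sum>n<N. survival j n i) \<le> real N"
      using sum_mono[of "{..<N}" "\<lambda>n. survival j n i" "\<lambda>_. 1"] survival_le_1 by simp
    also have "(\<Sum>n<K. survival j (n + N) i) \<le> (\<Sum>n<K. survival j n i) / 2"
      unfolding sum_divide_distrib using half[OF i] by (intro sum_mono)
    finally show ?thesis by simp
  qed
  then show ?thesis by blast
qed

lemma sum_first_passage_eq:
  "(\<Sum>n\<le>K. real n * first_passage_prob G i j n) + real K * survival j K i = (\<Sum>n<K. survival j n i)"
  by (induction K) (simp_all add: survival_Suc_diff algebra_simps)

lemma mean_first_passage_sums: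
  assumes "i \<in> V" "j \<in> V"
  shows "(\<lambda>n. real n * first_passage_prob G i j n) sums mean_first_passage G i j"
proof -
  obtain C where C: "\<And>K. (\<Sum>n<K. survival j n i) \<le> C"
    using sum_survival_bounded assms by blast
  have "(\<Sum>n<K. real n * first_passage_prob G i j n) \<le> C" for K
  proof -
    have "(\<Sum>n<K. real n * first_passage_prob G i j n)
        \<le> (\<Sum>n\<le>K. real n * first_passage_prob G i j n)"
      by (intro sum_mono2) (auto simp: first_passage_prob_nonneg)
    also have "\<dots> \<le> (\<Sum>n<K. survival j n i)"
      using sum_first_passage_eq[where i = i and j = j and K = K]
        mult_nonneg_nonneg[OF of_nat_0_le_iff survival_nonneg[OF assms, of K], of K] by linarith
    finally show ?thesis using C[of K] by simp
  qed
  then have "summable (\<lambda>n. real n * first_passage_prob G i j n)"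
    by (intro summableI_nonneg_bounded) (auto simp: first_passage_prob_nonneg)
  then show ?thesis unfolding mean_first_passage_def by (rule summable_sums)
qed

lemma mean_first_passage_nonneg:
  assumes "i \<in> V" "j \<in> V"
  shows "0 \<le> mean_first_passage G i j"
  using mean_first_passage_sums[OF assms] unfolding mean_first_passage_def
  by (intro suminf_nonneg) (auto simp: first_passage_prob_nonneg sums_iff)

lemma mean_first_passage_self:
  assumes "j \<in> V"
  shows "mean_first_passage G j j = 0"
proof -
  have "real n * first_passage_prob G j j n = 0" for n
    using assms by (cases n) (simp_all add: first_passage_prob_Suc)
  then show ?thesis unfolding mean_first_passage_def by (simp only: suminf_zero)
qed

lemma lap_mean_first_passage:
  assumes "i \<in> V" "j \<in> V"
  shows "lap E (\<lambda>z. mean_first_passage G z j) i = deg E i - (if i = j then real (card E) else 0)"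
proof -
  have off: "lap E (\<lambda>z. mean_first_passage G z j) i = deg E i"
    if i: "i \<in> V" "i \<noteq> j" for i
  proof -
    have "(\<lambda>n. \<Sum>x\<in>E `` {i}. real n * first_passage_prob G x j n + first_passage_prob G x j n)
        sums (\<Sum>x\<in>E `` {i}. mean_first_passage G x j + 1)"
      using Image_subset assms(2)
      by (intro sums_sum sums_add mean_first_passage_sums first_passage_prob_sums) blast+
    moreover have "(\<Sum>x\<in>E `` {i}. real n * first_passage_prob G x j n + first_passage_prob G x j n)
        = deg E i * (real (Suc n) * first_passage_prob G i j (Suc n))" for n
    proof -
      have "deg E i * first_passage_prob G i j (Suc n) = (\<Sum>x\<in>E `` {i}. first_passage_prob G x j n)"
        using deg_pos[OF i(1) assms(2) i(2)] i assms(2) by (simp add: first_passage_prob_Suc)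
      then have "deg E i * (real (Suc n) * first_passage_prob G i j (Suc n))
          = real (Suc n) * (\<Sum>x\<in>E `` {i}. first_passage_prob G x j n)"
        by (simp only: mult.left_commute)
      then show ?thesis by (simp add: sum.distrib sum_distrib_left algebra_simps)
    qed
    moreover have "(\<lambda>n. deg E i * (real (Suc n) * first_passage_prob G i j (Suc n)))
        sums (deg E i * mean_first_passage G i j)"
      using mean_first_passage_sums[OF i(1) assms(2)]
      by (intro sums_mult) (subst sums_Suc_iff, simp)
    ultimately have "(\<Sum>x\<in>E `` {i}. mean_first_passage G x j + 1) = deg E i * mean_first_passage G i j"
      using sums_unique2 by (metis (no_types, lifting) ext)
    then show ?thesis by (simp add: lap_def sum_subtractf sum.distrib deg_def)
  qed
  show ?thesis
  proof (cases "i = j")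
    case True
    have "0 = (\<Sum>x\<in>V. lap E (\<lambda>z. mean_first_passage G z j) x)" by (rule sum_lap[symmetric])
    also have "\<dots> = lap E (\<lambda>z. mean_first_passage G z j) j + (\<Sum>x\<in>V - {j}. deg E x)"
      using finite_V assms(2) off by (subst sum.remove[of _ j]) auto
    also have "(\<Sum>x\<in>V - {j}. deg E x) = real (card E) - deg E j"
      using finite_V assms(2) deg_sum_one sum.remove[of V j "deg E"] by (simp add: deg_sum_def)
    finally show ?thesis using True by simp
  next
    case False
    then show ?thesis using off assms by simp
  qed
qed

lemma stationary_eq: "stationary G x = deg E x / real (card E)"
proof -
  have "out_arcs (with_proj G) x = Pair x ` (E `` {x})"
    by (auto simp: out_arcs_def)
  then have "out_degree (with_proj G) x = card (E `` {x})"
    by (simp add: out_degree_def card_image inj_on_def)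
  then show ?thesis by (simp add: stationary_def deg_def)
qed

lemma deg_sum_eq_stationary:
  assumes "card E > 0"
  shows "deg_sum V E f = real (card E) * (\<Sum>x\<in>V. stationary G x * f x)"
  using assms by (simp add: deg_sum_def stationary_eq sum_distrib_left)

lemma sum_remove_self:
  assumes "v \<in> V" "f v = 0"
  shows "(\<Sum>x\<in>V - {v}. stationary G x * f x) = (\<Sum>x\<in>V. stationary G x * f x)"
  using finite_V assms by (simp add: sum.remove)

lemma deg_sum_accessibility:
  assumes "card E > 0" "v \<in> V"
  shows "deg_sum V E (\<lambda>x. mean_first_passage G x v) = real (card E) * accessibility G v"
  unfolding accessibility_def deg_sum_eq_stationary[OF assms(1)]
  using assms(2) mean_first_passage_self by (subst sum_remove_self) auto

lemma deg_sum_kemeny: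
  assumes "card E > 0" "x \<in> V"
  shows "deg_sum V E (\<lambda>y. mean_first_passage G x y) = real (card E) * kemeny G"
proof -
  define K where "K x = (\<Sum>y\<in>V. deg E y * mean_first_passage G x y)" for x
  define i where "i = (SOME i. i \<in> V)"
  have i: "i \<in> V" unfolding i_def using V_nonempty by (simp add: some_in_eq)
  have "lap E K x = 0" if "x \<in> V" for x
  proof -
    have "lap E K x = (\<Sum>y\<in>V. deg E y * (deg E x - (if x = y then real (card E) else 0)))"
      unfolding K_def lap_sum lap_cmult using that lap_mean_first_passage by (intro sum.cong) auto
    also have "\<dots> = deg_sum V E (\<lambda>_. deg E x) - (\<Sum>y\<in>V. if x = y then deg E x * real (card E) else 0)"
      unfolding deg_sum_def sum_subtractf[symmetric] by (intro sum.cong) (auto simp: algebra_simps)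
    also have "\<dots> = 0"
      using that finite_V by (simp add: deg_sum_const)
    finally show ?thesis .
  qed
  then have "K x = K i" using i assms(2) by (intro harmonic_eq)
  moreover have "K i = real (card E) * kemeny G"
    using deg_sum_eq_stationary[OF assms(1), of "mean_first_passage G i"]
      sum_remove_self[OF i, of "mean_first_passage G i"] mean_first_passage_self[OF i]
    by (simp add: kemeny_def Let_def i_def[symmetric] K_def deg_sum_def)
  ultimately show ?thesis by (simp add: K_def deg_sum_def)
qed

definition hitting_kernel :: "'a \<Rightarrow> 'a \<Rightarrow> real" where
  "hitting_kernel x y = 2 / real (card E) * mean_first_passage G x y"

lemma resistance_kernel_hitting: "resistance_kernel V E hitting_kernel"
  unfolding resistance_kernel_def
proof (intro conjI ballI)
  fix x assume "x \<in> V"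
  then show "hitting_kernel x x = 0" by (simp add: hitting_kernel_def mean_first_passage_self)
next
  fix x y assume "x \<in> V" "y \<in> V"
  then show "0 \<le> hitting_kernel x y" by (simp add: hitting_kernel_def mean_first_passage_nonneg)
next
  show "\<exists>\<tau>. \<forall>x\<in>V. \<forall>y\<in>V. lap E (\<lambda>z. hitting_kernel z y) x = \<tau> x - (if x = y then 2 else 0)"
  proof (cases "card E > 0")
    case True
    then have "2 / real (card E) * real (card E) = 2" by simp
    then show ?thesis
      by (intro exI[of _ "\<lambda>x. 2 / real (card E) * deg E x"])
        (simp add: hitting_kernel_def lap_cmult lap_mean_first_passage right_diff_distrib
          del: times_divide_eq_left)
  next
    case False
    then have "x = y" if "x \<in> V" "y \<in> V" for x y using card_pos[OF that] by metis
    moreover have "E = {}" using False finite_E by auto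
    ultimately show ?thesis by (intro exI[of _ "\<lambda>_. 2"]) (auto simp: lap_def)
  qed
qed

lemma kernel_at_hitting:
  assumes "card E > 0" "v \<in> V"
  shows "kernel_at V E hitting_kernel v = 2 * (accessibility G v + kemeny G)"
  unfolding kernel_at_def hitting_kernel_def deg_sum_add deg_sum_cmult
    deg_sum_accessibility[OF assms] deg_sum_kemeny[OF assms]
  using assms(1) by (simp add: algebra_simps)

lemma kernel_at_hitting_mono:
  assumes "v \<in> V" "w \<in> V" "accessibility G v \<le> accessibility G w"
  shows "kernel_at V E hitting_kernel v \<le> kernel_at V E hitting_kernel w"
proof (cases "card E > 0")
  case True
  then show ?thesis using assms by (simp add: kernel_at_hitting)
next
  case False
  then show ?thesis using finite_E by (simp add: kernel_at_def deg_sum_def deg_def)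
qed

lemma kernel_total_kemeny:
  assumes "card E > 0" and r: "resistance_kernel V E r"
  shows "kernel_total V E r = 2 * real (card E) * kemeny G"
proof -
  define A where "A = real (card E)"
  have A: "A > 0" using assms(1) by (simp add: A_def)
  let ?h = "mean_first_passage G"
  obtain \<tau> where \<tau>: "\<And>x y. x \<in> V \<Longrightarrow> y \<in> V \<Longrightarrow>
      lap E (\<lambda>z. r z y) x = \<tau> x - (if x = y then 2 else 0)"
    using r unfolding resistance_kernel_def by blast
  obtain y0 where y0: "y0 \<in> V" using V_nonempty by blast
  define \<phi> where "\<phi> x = ?h x y0 - A / 2 * r x y0" for x
  have h: "?h x y = A / 2 * r x y + (\<phi> x - \<phi> y)" if xy: "x \<in> V" "y \<in> V" for x y
  proof -
    define D where "D x = ?h x y - A / 2 * r x y - \<phi> x" for x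
    have lap_part: "lap E (\<lambda>z. ?h z y - A / 2 * r z y) x = deg E x - A / 2 * \<tau> x"
      if "x \<in> V" "y \<in> V" for x y
      using that unfolding lap_diff lap_cmult
      by (simp add: lap_mean_first_passage \<tau> A_def algebra_simps)
    have "lap E D x = 0" if "x \<in> V" for x
    proof -
      have "lap E D x = lap E (\<lambda>z. ?h z y - A / 2 * r z y) x - lap E (\<lambda>z. ?h z y0 - A / 2 * r z y0) x"
        unfolding D_def \<phi>_def by (rule lap_diff)
      then show ?thesis using lap_part[OF that xy(2)] lap_part[OF that y0] by simp
    qed
    then have "D x = D y" using xy by (intro harmonic_eq)
    moreover have "r y y = 0" using r xy(2) by (simp add: resistance_kernel_def)
    ultimately show ?thesis
      using mean_first_passage_self[OF xy(2)] by (simp add: D_def)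
  qed
  have "A * (A * kemeny G) = deg_sum V E (\<lambda>x. A * kemeny G)"
    by (simp add: deg_sum_const A_def)
  also have "\<dots> = deg_sum V E (\<lambda>x. deg_sum V E (?h x))"
    using deg_sum_kemeny[OF assms(1)] by (intro deg_sum_cong) (simp add: A_def)
  also have "\<dots> = deg_sum V E (\<lambda>x. deg_sum V E (\<lambda>y. A / 2 * r x y + (\<phi> x - \<phi> y)))"
    by (intro deg_sum_cong h)
  also have "\<dots> = A / 2 * kernel_total V E r + (deg_sum V E (\<lambda>x. A * \<phi> x) - A * deg_sum V E \<phi>)"
    unfolding deg_sum_add deg_sum_diff deg_sum_cmult deg_sum_const kernel_total_def
    by (simp add: A_def)
  finally have "A * (A * kemeny G) = A / 2 * kernel_total V E r"
    by (simp add: deg_sum_cmult)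
  then show ?thesis using A by (simp add: A_def)
qed

end

section \<open>Growing trees leaf by leaf\<close>

lemma network_connected_graph:
  assumes "connected_graph G"
  shows "network (pverts G) (parcs G)"
proof -
  interpret pair_graph G using assms by (simp add: connected_graph_def)
  have sc: "strongly_connected (mk_symmetric G)"
    using assms by (simp add: connected_graph_def Digraph_Component.connected_def)
  show ?thesis
  proof
    show "finite (pverts G)" by (rule pair_finite_verts)
    show "pverts G \<noteq> {}"
      using sc by (auto simp: strongly_connected_def mk_symmetric_def)
    show "parcs G \<subseteq> pverts G \<times> pverts G" by (auto dest: wellformed')
    show "sym (parcs G)" by (rule symI) (rule arcs_symmetric)
    fix S assume S: "S \<subseteq> pverts G" "S \<noteq> {}" "parcs G `` S \<subseteq> S"
    have "y \<in> S" if "y \<in> pverts G" for y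
    proof -
      obtain x where x: "x \<in> S" using S(2) by blast
      have "x \<rightarrow>\<^sup>*\<^bsub>with_proj (mk_symmetric G)\<^esub> y"
        using sc x S(1) that by (auto simp: strongly_connected_def mk_symmetric_def)
      then have "x \<rightarrow>\<^sup>*\<^bsub>with_proj G\<^esub> y"
        using reachable_mk_symmetric_eq[OF sym_arcs] by simp
      then show ?thesis
      proof (induction rule: reachable_induct)
        case base
        show ?case by (rule x)
      next
        case (step a b)
        then show ?case using S(3) by (auto simp: arcs_ends_def arc_to_ends_def)
      qed
    qed
    then show "S = pverts G" using S(1) by blast
  qed
qed

lemma pcas_snoc: "pcas u p w \<Longrightarrow> pcas u (p @ [(w, z)]) z"
  by (induction u p w rule: pcas.induct) auto

lemma pawalk_verts_snoc: "pcas u p w \<Longrightarrow> pawalk_verts u (p @ [(w, z)]) = pawalk_verts u p @ [z]"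
  by (induction u p w rule: pcas.induct) auto

definition linked_in :: "'a rel \<Rightarrow> 'a set \<Rightarrow> bool" where
  "linked_in E S \<longleftrightarrow> (\<forall>a\<in>S. \<forall>b\<in>S. \<exists>p. set p \<subseteq> E \<and> pcas a p b \<and>
     distinct (pawalk_verts a p) \<and> set (pawalk_verts a p) \<subseteq> S)"

lemma linked_in_insert:
  assumes S: "linked_in E S" and s: "s \<in> S" "j \<notin> S" "(s, j) \<in> E" "(j, s) \<in> E"
  shows "linked_in E (insert j S)"
  unfolding linked_in_def
proof (intro ballI)
  fix a b assume ab: "a \<in> insert j S" "b \<in> insert j S"
  note path = S[unfolded linked_in_def, rule_format]
  consider "a \<in> S" "b \<in> S" | "a = j" "b = j" | "a = j" "b \<in> S" | "a \<in> S" "b = j"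
    using ab by auto
  then show "\<exists>p. set p \<subseteq> E \<and> pcas a p b \<and> distinct (pawalk_verts a p) \<and>
      set (pawalk_verts a p) \<subseteq> insert j S"
  proof cases
    case 1
    then show ?thesis using path[of a b] by blast
  next
    case 2
    then show ?thesis by (intro exI[of _ "[]"]) auto
  next
    case 3
    then obtain p where "set p \<subseteq> E" "pcas s p b" "distinct (pawalk_verts s p)"
        "set (pawalk_verts s p) \<subseteq> S"
      using path[OF s(1), of b] by blast
    then show ?thesis using 3 s by (intro exI[of _ "(j, s) # p"]) auto
  next
    case 4
    then obtain p where "set p \<subseteq> E" "pcas a p s" "distinct (pawalk_verts a p)"
        "set (pawalk_verts a p) \<subseteq> S"
      using path[OF _ s(1), of a] by blast
    then show ?thesis using 4 s
      by (intro exI[of _ "p @ [(s, j)]"]) (auto simp: pcas_snoc pawalk_verts_snoc)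
  qed
qed

lemma tree_unique_neighbour:
  assumes T: "tree_graph T" and S: "linked_in (parcs T) S" "s \<in> S" "s' \<in> S" "j \<notin> S"
    and arcs: "(j, s) \<in> parcs T" "(s', j) \<in> parcs T"
  shows "s' = s"
proof (rule ccontr)
  assume "s' \<noteq> s"
  interpret network "pverts T" "parcs T"
    using T by (intro network_connected_graph) (simp add: tree_graph_def)
  obtain p where p: "set p \<subseteq> parcs T" "pcas s p s'" "distinct (pawalk_verts s p)"
      "set (pawalk_verts s p) \<subseteq> S"
    using S unfolding linked_in_def by blast
  define w where "w = (j, s) # p @ [(s', j)]"
  have "p \<noteq> []" using p(2) \<open>s' \<noteq> s\<close> by auto
  then have "3 \<le> length w" by (cases p) (auto simp: w_def)
  moreover have "pre_digraph.awalk (with_proj T) j w j"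
    unfolding pre_digraph.awalk_def cas_with_proj_eq
    using p arcs E_subset by (auto simp: w_def pcas_snoc)
  moreover have "distinct (tl (pawalk_verts j w))"
    using p S(4) by (auto simp: w_def pawalk_verts_snoc)
  ultimately have "pre_digraph.cycle (with_proj T) w"
    unfolding pre_digraph.cycle_def awalk_verts_with_proj_eq by (auto simp: w_def)
  then show False using T \<open>3 \<le> length w\<close> by (auto simp: tree_graph_def)
qed

lemma tree_grow_induct [consumes 2, case_names root leaf]:
  assumes T: "tree_graph T" and root: "i0 \<in> pverts T"
    and base: "P {i0}"
    and step: "\<And>S s j. \<lbrakk>S \<subseteq> pverts T; i0 \<in> S; s \<in> S; j \<in> pverts T - S; (s, j) \<in> parcs T;
      \<And>s'. s' \<in> S \<Longrightarrow> (s', j) \<in> parcs T \<Longrightarrow> s' = s; P S\<rbrakk> \<Longrightarrow> P (insert j S)"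
  shows "P (pverts T)"
proof -
  interpret network "pverts T" "parcs T"
    using T by (intro network_connected_graph) (simp add: tree_graph_def)
  have "P (pverts T)" if "S \<subseteq> pverts T" "i0 \<in> S" "linked_in (parcs T) S" "P S" for S
    using that
  proof (induction "card (pverts T - S)" arbitrary: S rule: less_induct)
    case less
    show ?case
    proof (cases "S = pverts T")
      case True
      then show ?thesis using less.prems by simp
    next
      case False
      then obtain s j where sj: "s \<in> S" "j \<notin> S" "(s, j) \<in> parcs T"
        using closed_eq_V[of S] less.prems(1,2) by blast
      then have j: "j \<in> pverts T" "(j, s) \<in> parcs T"
        using E_subset sym_E by (auto dest: symD)
      have "linked_in (parcs T) (insert j S)"
        using less.prems(3) sj(1,2,3) j(2) by (rule linked_in_insert)
      moreover have "P (insert j S)"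
        using less.prems(1,2) sj(1) _ sj(3) _ less.prems(4)
      proof (rule step)
        show "j \<in> pverts T - S" using sj j by simp
        fix s' assume "s' \<in> S" "(s', j) \<in> parcs T"
        with T less.prems(3) sj(1) show "s' = s"
          using sj(2) j(2) by (intro tree_unique_neighbour)
      qed
      moreover have "card (pverts T - insert j S) < card (pverts T - S)"
        using finite_V sj j by (intro psubset_card_mono) auto
      ultimately show ?thesis using less.hyps[of "insert j S"] less.prems(1,2) j by blast
    qed
  qed
  moreover have "linked_in (parcs T) {i0}"
    unfolding linked_in_def by (auto intro: exI[of _ "[]"])
  ultimately show ?thesis using root base by blast
qed

definition copy_arcs :: "'b \<Rightarrow> 'a rel \<Rightarrow> ('b \<times> 'a) rel" where
  "copy_arcs j E = (\<lambda>(x, y). ((j, x), (j, y))) ` E"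

lemma Image_copy_arcs: "copy_arcs j E `` {(j, x)} = Pair j ` (E `` {x})"
  unfolding copy_arcs_def by force

lemma card_copy_arcs: "card (copy_arcs j E) = card E"
  unfolding copy_arcs_def by (intro card_image) (auto simp: inj_on_def)

lemma deg_copy: "deg (copy_arcs j E) (j, x) = deg E x"
  unfolding deg_def Image_copy_arcs by (simp add: card_image inj_on_def)

lemma lap_copy: "lap (copy_arcs j E) u (j, x) = lap E (\<lambda>y. u (j, y)) x"
  unfolding lap_def Image_copy_arcs by (simp add: sum.reindex inj_on_def)

lemma deg_sum_copy: "deg_sum ({j} \<times> V) (copy_arcs j E) u = deg_sum V E (\<lambda>x. u (j, x))"
proof -
  have "{j} \<times> V = Pair j ` V" by auto
  then show ?thesis unfolding deg_sum_def by (simp add: sum.reindex inj_on_def deg_copy)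
qed

context network
begin

lemma network_copy: "network ({j} \<times> V) (copy_arcs j E)"
proof
  show "finite ({j} \<times> V)" "{j} \<times> V \<noteq> {}" using finite_V V_nonempty by auto
  show "copy_arcs j E \<subseteq> ({j} \<times> V) \<times> {j} \<times> V" using E_subset by (auto simp: copy_arcs_def)
  show "sym (copy_arcs j E)" using sym_E by (force simp: copy_arcs_def sym_def)
  fix S assume S: "S \<subseteq> {j} \<times> V" "S \<noteq> {}" "copy_arcs j E `` S \<subseteq> S"
  have "{x. (j, x) \<in> S} = V"
  proof (rule closed_eq_V)
    show "E `` {x. (j, x) \<in> S} \<subseteq> {x. (j, x) \<in> S}"
    proof clarify
      fix x y assume "(j, x) \<in> S" "(x, y) \<in> E"
      then have "(j, y) \<in> copy_arcs j E `` S" by (force simp: copy_arcs_def)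
      then show "(j, y) \<in> S" using S(3) by blast
    qed
  qed (use S(1,2) in auto)
  then show "S = {j} \<times> V" using S(1) by auto
qed

lemma resistance_kernel_copy:
  "resistance_kernel V E r \<Longrightarrow> resistance_kernel ({j} \<times> V) (copy_arcs j E) (\<lambda>a b. r (snd a) (snd b))"
  unfolding resistance_kernel_def
  by (elim conjE exE, intro conjI exI[of _ "\<tau> \<circ> snd" for \<tau>]) (auto simp: lap_copy)

lemma kernel_total_copy:
  "kernel_total ({j} \<times> V) (copy_arcs j E) (\<lambda>a b. r (snd a) (snd b)) = kernel_total V E r"
  unfolding kernel_total_def deg_sum_copy by simp

lemma kernel_at_copy:
  "kernel_at ({j} \<times> V) (copy_arcs j E) (\<lambda>a b. r (snd a) (snd b)) (j, x) = kernel_at V E r x"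
  unfolding kernel_at_def deg_sum_copy by simp

end

section \<open>Chains of copies\<close>

definition chain_arcs :: "'a rel \<Rightarrow> nat rel \<Rightarrow> (nat \<Rightarrow> nat \<Rightarrow> 'a) \<Rightarrow> nat set \<Rightarrow> (nat \<times> 'a) rel" where
  "chain_arcs E B c S = (\<Union>i\<in>S. copy_arcs i E) \<union>
     (\<lambda>(i, j). ((i, c i j), (j, c j i))) ` (B \<inter> S \<times> S)"

lemma chain_arcs_singleton: "(i, i) \<notin> B \<Longrightarrow> chain_arcs E B c {i} = copy_arcs i E"
  by (auto simp: chain_arcs_def)

lemma chain_arcs_insert:
  assumes "sym B" "(j, j) \<notin> B" "s \<in> S" "(s, j) \<in> B" "\<forall>s'\<in>S. (s', j) \<in> B \<longrightarrow> s' = s"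
  shows "chain_arcs E B c (insert j S)
    = chain_arcs E B c S \<union> copy_arcs j E \<union> {((s, c s j), (j, c j s)), ((j, c j s), (s, c s j))}"
proof -
  have js: "(j, s) \<in> B" using assms(1,4) by (rule symD)
  have "\<forall>s'\<in>S. (j, s') \<in> B \<longrightarrow> s' = s" using assms(1,5) by (meson symD)
  then have "B \<inter> {j} \<times> S = {(j, s)}" using js assms(3) by blast
  moreover have "B \<inter> S \<times> {j} = {(s, j)}" using assms(3-5) by blast
  moreover have "B \<inter> {j} \<times> {j} = {}" using assms(2) by blast
  moreover have "insert j S \<times> insert j S = S \<times> S \<union> S \<times> {j} \<union> {j} \<times> S \<union> {j} \<times> {j}" by blast
  ultimately have "B \<inter> insert j S \<times> insert j S = B \<inter> S \<times> S \<union> {(s, j), (j, s)}"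
    by (simp only: Int_Un_distrib) blast
  then show ?thesis unfolding chain_arcs_def by auto
qed

definition chain_total :: "real \<Rightarrow> real \<Rightarrow> real \<Rightarrow> nat \<Rightarrow> real" where
  "chain_total A Q \<rho> n = real n * Q + real n * (real n - 1) * (A + 2) * \<rho>
     + 2 * (real n - 1) * (A + 1) * ((real n - 1) * (A + 2) - 1)"

definition chain_at :: "real \<Rightarrow> real \<Rightarrow> nat \<Rightarrow> real" where
  "chain_at A \<rho> n = real n * \<rho> + 2 * (real n - 1) * (A + 1)"

lemma chain_at_Suc: "chain_at A \<rho> (Suc n) = chain_at A \<rho> n + 2 * (A + 1) + \<rho>"
  by (simp add: chain_at_def algebra_simps)

lemma chain_total_Suc:
  "chain_total A Q \<rho> (Suc n) = chain_total A Q \<rho> n + Q + (A + 2) * chain_at A \<rho> n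
     + real n * (A + 2) * \<rho> + 2 * (real n * (A + 2) - 1) * (A + 1)"
  by (simp add: chain_total_def chain_at_def algebra_simps)

lemma chain_resistance_kernel:
  fixes T :: "nat pair_pre_digraph" and i0 :: nat
  assumes net: "network V E" and r0: "resistance_kernel V E r0"
    and v: "v \<in> V" and min: "\<forall>w\<in>V. kernel_at V E r0 v \<le> kernel_at V E r0 w"
    and T: "tree_graph T" and i0: "i0 \<in> pverts T"
    and c: "\<forall>(i, j)\<in>parcs T. c i j \<in> V"
  defines "A \<equiv> real (card E)" and "Q \<equiv> kernel_total V E r0" and "\<rho> \<equiv> kernel_at V E r0 v"
    and "optimal \<equiv> (\<forall>x\<in>pverts T - {i0}. (i0, x) \<in> parcs T) \<and> (\<forall>(i, j)\<in>parcs T. c i j = v)"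
    and "W \<equiv> pverts T \<times> V" and "F \<equiv> chain_arcs E (parcs T) c (pverts T)"
  shows "\<exists>r. network W F \<and> resistance_kernel W F r \<and>
    real (card F) + 2 = real (card (pverts T)) * (A + 2) \<and>
    chain_total A Q \<rho> (card (pverts T)) \<le> kernel_total W F r \<and>
    (optimal \<longrightarrow> kernel_total W F r = chain_total A Q \<rho> (card (pverts T)))"
proof -
  interpret H: network V E by (rule net)
  interpret TG: pair_graph T using T by (simp add: tree_graph_def connected_graph_def)
  have sym: "sym (parcs T)" by (rule symI) (rule TG.arcs_symmetric)
  have irrefl: "(i, i) \<notin> parcs T" for i using TG.no_loops' by blast
  have A: "0 \<le> A" by (simp add: A_def)
  define P where "P S r \<longleftrightarrow> network (S \<times> V) (chain_arcs E (parcs T) c S) \<and>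
    resistance_kernel (S \<times> V) (chain_arcs E (parcs T) c S) r \<and>
    real (card (chain_arcs E (parcs T) c S)) + 2 = real (card S) * (A + 2) \<and>
    chain_total A Q \<rho> (card S) \<le> kernel_total (S \<times> V) (chain_arcs E (parcs T) c S) r \<and>
    (\<forall>x\<in>S \<times> V. chain_at A \<rho> (card S) \<le> kernel_at (S \<times> V) (chain_arcs E (parcs T) c S) r x) \<and>
    (optimal \<longrightarrow>
      kernel_total (S \<times> V) (chain_arcs E (parcs T) c S) r = chain_total A Q \<rho> (card S) \<and>
      kernel_at (S \<times> V) (chain_arcs E (parcs T) c S) r (i0, v) = chain_at A \<rho> (card S))" for S r
  have "\<exists>r. P (pverts T) r"
    using T i0
  proof (induction rule: tree_grow_induct)
    case root
    have "P {i0} (\<lambda>a b. r0 (snd a) (snd b))"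
      unfolding P_def chain_arcs_singleton[OF irrefl]
      using H.network_copy H.resistance_kernel_copy[OF r0] min
      by (auto simp: H.kernel_total_copy H.kernel_at_copy card_copy_arcs A_def Q_def \<rho>_def
          chain_total_def chain_at_def)
    then show ?case by blast
  next
    case (leaf S s j)
    obtain r1 where r1: "P S r1" using leaf by blast
    define E1 where "E1 = chain_arcs E (parcs T) c S"
    define E2 where "E2 = copy_arcs j E"
    define r2 where "r2 = (\<lambda>(a :: nat \<times> 'a) (b :: nat \<times> 'a). r0 (snd a) (snd b))"
    define p where "p = (s, c s j)"
    define q where "q = (j, c j s)"
    have js: "(j, s) \<in> parcs T" using leaf(5) by (rule TG.arcs_symmetric)
    have pV: "p \<in> S \<times> V" and qV: "q \<in> {j} \<times> V"
      using leaf(3,5) js c by (auto simp: p_def q_def)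
    note r1' = r1[unfolded P_def, folded E1_def]
    have kernel1: "resistance_kernel (S \<times> V) E1 r1" using r1' by blast
    have kernel2: "resistance_kernel ({j} \<times> V) E2 r2"
      unfolding E2_def r2_def by (rule H.resistance_kernel_copy[OF r0])
    interpret B: bridged "S \<times> V" E1 "{j} \<times> V" E2 p q
    proof (intro bridged.intro bridged_axioms.intro)
      show "network (S \<times> V) E1" using r1' by blast
      show "network ({j} \<times> V) E2" unfolding E2_def by (rule H.network_copy)
      show "(S \<times> V) \<inter> ({j} \<times> V) = {}" using leaf(4) by auto
    qed (fact pV qV)+
    have BV: "B.V = insert j S \<times> V" unfolding B.V_def by auto
    have BE: "B.E = chain_arcs E (parcs T) c (insert j S)"
      using chain_arcs_insert[OF sym irrefl leaf(3,5), of E c] leaf(6)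
      by (simp add: B.E_def) (simp add: E1_def E2_def p_def q_def)
    have "finite S" using leaf(1) TG.pair_finite_verts finite_subset by blast
    then have n: "card (insert j S) = Suc (card S)" using leaf(4) by simp
    have "1 \<le> card S" using \<open>finite S\<close> leaf(2) by (simp add: Suc_le_eq card_gt_0_iff) blast
    define n where "n = card S"
    have c1: "real (card E1) = real n * (A + 2) - 2" using r1' by (simp add: n_def)
    have c2: "real (card E2) = A" by (simp add: E2_def card_copy_arcs A_def)
    have "A + 2 \<le> real n * (A + 2)"
      using \<open>1 \<le> card S\<close> A by (simp add: n_def mult_le_cancel_right1)
    then have c12: "A \<le> real (card E1)" using c1 by simp
    have tot1: "chain_total A Q \<rho> n \<le> kernel_total (S \<times> V) E1 r1"
      and at1: "\<And>x. x \<in> S \<times> V \<Longrightarrow> chain_at A \<rho> n \<le> kernel_at (S \<times> V) E1 r1 x"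
      and opt1: "optimal \<Longrightarrow> kernel_total (S \<times> V) E1 r1 = chain_total A Q \<rho> n"
        "optimal \<Longrightarrow> kernel_at (S \<times> V) E1 r1 (i0, v) = chain_at A \<rho> n"
      using r1' by (auto simp: n_def)
    have tot2: "kernel_total ({j} \<times> V) E2 r2 = Q"
      by (simp add: E2_def r2_def H.kernel_total_copy Q_def)
    have at2: "kernel_at ({j} \<times> V) E2 r2 (j, x) = kernel_at V E r0 x" for x
      by (simp add: E2_def r2_def H.kernel_at_copy)
    have at2_ge: "\<rho> \<le> kernel_at ({j} \<times> V) E2 r2 x" if "x \<in> {j} \<times> V" for x
      using that min by (auto simp: at2 \<rho>_def)
    have nonneg1: "0 \<le> r1 x y" if "x \<in> S \<times> V" "y \<in> S \<times> V" for x y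
      using kernel1 that unfolding resistance_kernel_def by blast
    have nonneg2: "0 \<le> r2 x y" if "x \<in> {j} \<times> V" "y \<in> {j} \<times> V" for x y
      using kernel2 that unfolding resistance_kernel_def by blast
    let ?r = "B.glued r1 r2"
    have tot: "kernel_total B.V B.E ?r = kernel_total (S \<times> V) E1 r1 + Q
        + (A + 2) * kernel_at (S \<times> V) E1 r1 p + real n * (A + 2) * kernel_at ({j} \<times> V) E2 r2 q
        + 2 * (real n * (A + 2) - 1) * (A + 1)"
      unfolding B.kernel_total_glued[OF kernel1 kernel2] tot2 c2 c1 by simp
    have "P (insert j S) ?r"
      unfolding P_def BV[symmetric] BE[symmetric] n n_def[symmetric]
    proof (intro conjI impI ballI)
      show "network B.V B.E" by (rule B.network)
      show "resistance_kernel B.V B.E ?r" by (rule B.resistance_kernel_glued[OF kernel1 kernel2])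
      show "real (card B.E) + 2 = real (Suc n) * (A + 2)"
        using B.card_E c1 c2 by (simp add: algebra_simps)
      have "(A + 2) * chain_at A \<rho> n \<le> (A + 2) * kernel_at (S \<times> V) E1 r1 p"
        using A at1[OF pV] by (intro mult_left_mono) auto
      moreover have "real n * (A + 2) * \<rho> \<le> real n * (A + 2) * kernel_at ({j} \<times> V) E2 r2 q"
        using A at2_ge[OF qV] by (intro mult_left_mono) auto
      ultimately show "chain_total A Q \<rho> (Suc n) \<le> kernel_total B.V B.E ?r"
        unfolding tot chain_total_Suc using tot1 by linarith
    next
      fix x assume "x \<in> B.V"
      then consider "x \<in> S \<times> V" | "x \<in> {j} \<times> V" unfolding B.V_def by blast
      then show "chain_at A \<rho> (Suc n) \<le> kernel_at B.V B.E ?r x"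
      proof cases
        case 1
        have "0 \<le> (A + 2) * (r1 x p + r1 p x)"
          using A nonneg1 1 pV by simp
        then show ?thesis
          unfolding B.kernel_at_glued[OF kernel1 kernel2 1] chain_at_Suc c2
          using at1[OF 1] at2_ge[OF qV] by linarith
      next
        case 2
        have "0 \<le> (real (card E1) + 2) * (r2 x q + r2 q x)"
          using nonneg2 2 qV by simp
        then show ?thesis
          unfolding B.kernel_at_glued'[OF kernel1 kernel2 2] chain_at_Suc
          using at1[OF pV] at2_ge[OF 2] c12 by argo
      qed
    next
      assume opt: optimal
      then have "(i0, j) \<in> parcs T" using leaf(2,4) by (auto simp: optimal_def)
      then have "i0 = s" using leaf(2,6) by blast
      then have p: "p = (i0, v)" and q: "q = (j, v)"
        using opt leaf(5) js by (auto simp: optimal_def p_def q_def)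
      have pp: "r1 p p = 0" using kernel1 pV unfolding resistance_kernel_def by blast
      show "kernel_total B.V B.E ?r = chain_total A Q \<rho> (Suc n)"
        unfolding tot chain_total_Suc opt1(1)[OF opt] using opt1(2)[OF opt]
        by (simp add: p q at2 \<rho>_def)
      show "kernel_at B.V B.E ?r (i0, v) = chain_at A \<rho> (Suc n)"
        unfolding p[symmetric] B.kernel_at_glued[OF kernel1 kernel2 pV] chain_at_Suc c2
        using opt1(2)[OF opt] by (simp add: p[symmetric] pp) (simp add: q at2 \<rho>_def)
    qed
    then show ?case by blast
  qed
  then show ?thesis unfolding P_def W_def F_def by blast
qed

lemma chain_graph_copies:
  assumes "tree_graph T"
  shows "pverts (chain_graph (\<lambda>_. H) T c) = pverts T \<times> pverts H"
    and "parcs (chain_graph (\<lambda>_. H) T c) = chain_arcs (parcs H) (parcs T) c (pverts T)"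
proof -
  interpret network "pverts T" "parcs T"
    using assms by (intro network_connected_graph) (simp add: tree_graph_def)
  show "pverts (chain_graph (\<lambda>_. H) T c) = pverts T \<times> pverts H"
    by (simp add: chain_graph_def)
  show "parcs (chain_graph (\<lambda>_. H) T c) = chain_arcs (parcs H) (parcs T) c (pverts T)"
  proof -
    have "{((i, x), (i, y)) | i x y. i \<in> pverts T \<and> (x, y) \<in> parcs H}
        = (\<Union>i\<in>pverts T. copy_arcs i (parcs H))"
      unfolding copy_arcs_def by force
    moreover have "chain_bridges T c = (\<lambda>(i, j). ((i, c i j), (j, c j i))) ` parcs T"
      unfolding chain_bridges_def by force
    moreover have "parcs T \<inter> pverts T \<times> pverts T = parcs T"
      using E_subset by (rule Int_absorb2)
    ultimately show ?thesis by (simp add: chain_graph_def chain_arcs_def)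
  qed
qed

lemma kemeny_chain:
  assumes k: "k \<ge> 2" and H: "connected_graph H" and v: "v \<in> pverts H"
    and min: "\<And>w. w \<in> pverts H \<Longrightarrow> accessibility H v \<le> accessibility H w"
  shows "\<exists>m. \<forall>T c. tree_graph T \<longrightarrow> pverts T = {1..k} \<longrightarrow> chain_choice (\<lambda>_. H) T c \<longrightarrow>
    m \<le> kemeny (chain_graph (\<lambda>_. H) T c) \<and>
    (star_graph T \<and> (\<forall>(i, j)\<in>parcs T. c i j = v) \<longrightarrow> kemeny (chain_graph (\<lambda>_. H) T c) = m)"
proof -
  interpret H: walk H using network_connected_graph[OF H] by (simp add: walk_def)
  let ?A = "real (card (parcs H))"
  let ?r = "H.hitting_kernel"
  let ?total = "chain_total ?A (kernel_total (pverts H) (parcs H) ?r)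
    (kernel_at (pverts H) (parcs H) ?r v) k"
  define M where "M = real k * (?A + 2) - 2"
  have "2 * 2 \<le> real k * (?A + 2)" using k by (intro mult_mono) auto
  then have M: "0 < M" by (simp add: M_def)
  have "?total / (2 * M) \<le> kemeny (chain_graph (\<lambda>_. H) T c) \<and>
    ((\<forall>x\<in>pverts T - {i0}. (i0, x) \<in> parcs T) \<and> (\<forall>(i, j)\<in>parcs T. c i j = v) \<longrightarrow>
      kemeny (chain_graph (\<lambda>_. H) T c) = ?total / (2 * M))"
    if T: "tree_graph T" "pverts T = {1..k}" "chain_choice (\<lambda>_. H) T c" and i0: "i0 \<in> pverts T"
    for T i0 and c :: "nat \<Rightarrow> nat \<Rightarrow> 'a"
  proof -
    let ?G = "chain_graph (\<lambda>_. H) T c"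
    have min': "\<forall>w\<in>pverts H.
        kernel_at (pverts H) (parcs H) ?r v \<le> kernel_at (pverts H) (parcs H) ?r w"
      using H.kernel_at_hitting_mono[OF v _ min] by blast
    have "card (pverts T) = k" using T(2) by simp
    from chain_resistance_kernel[OF H.network_axioms H.resistance_kernel_hitting v min'
        T(1) i0 T(3)[unfolded chain_choice_def], folded chain_graph_copies[OF T(1), of H c], unfolded this]
    obtain r where r: "network (pverts ?G) (parcs ?G) \<and> resistance_kernel (pverts ?G) (parcs ?G) r \<and>
        real (card (parcs ?G)) + 2 = real k * (?A + 2) \<and>
        ?total \<le> kernel_total (pverts ?G) (parcs ?G) r \<and>
        ((\<forall>x\<in>pverts T - {i0}. (i0, x) \<in> parcs T) \<and> (\<forall>(i, j)\<in>parcs T. c i j = v) \<longrightarrow>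
          kernel_total (pverts ?G) (parcs ?G) r = ?total)"
      by (rule exE)
    note r = r[THEN conjunct1] r[THEN conjunct2, THEN conjunct1]
      r[THEN conjunct2, THEN conjunct2, THEN conjunct1]
      r[THEN conjunct2, THEN conjunct2, THEN conjunct2, THEN conjunct1]
      r[THEN conjunct2, THEN conjunct2, THEN conjunct2, THEN conjunct2, rule_format]
    have cardM: "real (card (parcs ?G)) = M" using r(3) by (simp add: M_def)
    interpret G: walk ?G using r(1) by (simp add: walk_def)
    have "kernel_total (pverts ?G) (parcs ?G) r = 2 * M * kemeny ?G"
      using G.kernel_total_kemeny[OF _ r(2)] M unfolding cardM[symmetric] by simp
    then have "kemeny ?G = kernel_total (pverts ?G) (parcs ?G) r / (2 * M)"
      using M by simp
    then show ?thesis using r(4,5) M by (simp add: divide_right_mono)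
  qed
  note bound = this
  show ?thesis
  proof (intro exI[of _ "?total / (2 * M)"] allI impI conjI)
    fix T and c :: "nat \<Rightarrow> nat \<Rightarrow> 'a"
    assume T: "tree_graph T" "pverts T = {1..k}" "chain_choice (\<lambda>_. H) T c"
    show "?total / (2 * M) \<le> kemeny (chain_graph (\<lambda>_. H) T c)"
      using bound[OF T, of 1] T(2) k by simp
    assume opt: "star_graph T \<and> (\<forall>(i, j)\<in>parcs T. c i j = v)"
    then obtain i0 where "i0 \<in> pverts T" "\<forall>x\<in>pverts T - {i0}. (i0, x) \<in> parcs T"
      by (auto simp: star_graph_def)
    then show "kemeny (chain_graph (\<lambda>_. H) T c) = ?total / (2 * M)"
      using bound[OF T] opt by blast
  qed
qed

lemma star_graph_exists:
  assumes "finite V" "v \<in> V"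
  shows "\<exists>S. star_graph S \<and> pverts S = V"
proof -
  define S where "S = \<lparr>pverts = V, parcs = {(v, x) | x. x \<in> V - {v}} \<union> {(x, v) | x. x \<in> V - {v}}\<rparr>"
  have arcs: "(x, y) \<in> parcs S \<longleftrightarrow> x \<in> V \<and> y \<in> V \<and> (x = v) \<noteq> (y = v)" for x y
    using assms(2) by (auto simp: S_def)
  have verts: "pverts S = V" by (simp add: S_def)
  have arcs_subset: "parcs S \<subseteq> V \<times> V" using arcs by auto
  interpret S: pair_graph S
  proof
    show "finite (pverts S)" "finite (parcs S)"
      using assms(1) arcs_subset by (auto simp: verts intro: finite_subset)
    show "symmetric (with_proj S)" by (auto simp: symmetric_def sym_def arcs)
  qed (use arcs verts in auto)
  have reach: "x \<rightarrow>\<^sup>*\<^bsub>with_proj S\<^esub> v" "v \<rightarrow>\<^sup>*\<^bsub>with_proj S\<^esub> x" if "x \<in> V" for x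
    using that arcs assms(2) S.reachable_adjI S.reachable_refl verts
    by (cases "x = v"; auto)+
  have "Digraph_Component.connected (with_proj S)"
    unfolding Digraph_Component.connected_def
  proof (rule strongly_connectedI)
    show "verts (with_proj (mk_symmetric (with_proj S))) \<noteq> {}"
      using assms(2) verts by (auto simp: mk_symmetric_def)
    fix x y assume "x \<in> verts (with_proj (mk_symmetric (with_proj S)))"
      "y \<in> verts (with_proj (mk_symmetric (with_proj S)))"
    then have "x \<in> V" "y \<in> V" using verts by (auto simp: mk_symmetric_def)
    then show "x \<rightarrow>\<^sup>*\<^bsub>with_proj (mk_symmetric (with_proj S))\<^esub> y"
      using S.reachable_trans[OF reach(1) reach(2)]
      unfolding S.reachable_mk_symmetric_eq[OF S.sym_arcs] by simp
  qed
  moreover have "\<not> (pre_digraph.cycle (with_proj S) p \<and> 3 \<le> length p)" for p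
  proof
    assume p: "pre_digraph.cycle (with_proj S) p \<and> 3 \<le> length p"
    then obtain e1 e2 e3 es where p_eq: "p = e1 # e2 # e3 # es"
      by (auto simp: numeral_3_eq_3 Suc_le_length_iff)
    obtain u where u: "set p \<subseteq> parcs S" "pcas u p u" "distinct (tl (pawalk_verts u p))"
      using p unfolding pre_digraph.cycle_def pre_digraph.awalk_def cas_with_proj_eq
        awalk_verts_with_proj_eq by auto
    have "u \<in> set (pawalk_verts w es)" if "pcas w es u" for w
      using that by (induction w es u rule: pcas.induct) auto
    moreover have "w \<in> set (pawalk_verts w es)" if "pcas w es u" for w
      using that by (cases es) auto
    moreover have "fst e3 \<noteq> snd e3" using u(1) arcs p_eq by (cases e3) auto
    ultimately show False
      using u arcs unfolding p_eq by (cases e1; cases e2; cases e3) auto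
  qed
  ultimately have "tree_graph S"
    using S.pair_graph by (auto simp: tree_graph_def connected_graph_def)
  then have "star_graph S" using assms(2) arcs verts by (auto simp: star_graph_def)
  then show ?thesis using verts by blast
qed

theorem proposition3p21:
  fixes k :: nat and H :: "'a pair_pre_digraph" and v :: 'a
  assumes "k \<ge> 2"
    and "connected_graph H"
    and "v \<in> pverts H"
    and "\<And>w. w \<in> pverts H \<Longrightarrow> accessibility H v \<le> accessibility H w"
  defines "optimal \<equiv> (\<lambda>(S :: nat pair_pre_digraph) (c :: nat \<Rightarrow> nat \<Rightarrow> 'a).
      star_graph S \<and> pverts S = {1..k} \<and> chain_choice (\<lambda>_. H) S c \<and>
      (\<forall>(x, y)\<in>chain_bridges S c. snd x = v \<and> snd y = v))"
  shows "(\<exists>S c. optimal S c) \<and>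
    (\<forall>S c. optimal S c \<longrightarrow>
       is_arg_min kemeny (is_chain k (\<lambda>_. H)) (chain_graph (\<lambda>_. H) S c))"
proof (intro conjI allI impI)
  obtain S :: "nat pair_pre_digraph" where "star_graph S" "pverts S = {1..k}"
    using star_graph_exists[of "{1..k}" 1] assms(1) by auto
  then have "optimal S (\<lambda>_ _. v)"
    using assms(3) by (auto simp: optimal_def chain_choice_def chain_bridges_def)
  then show "\<exists>S c. optimal S c" by blast
next
  fix S c assume opt: "optimal S c"
  obtain m where m: "\<And>T c. tree_graph T \<Longrightarrow> pverts T = {1..k} \<Longrightarrow> chain_choice (\<lambda>_. H) T c \<Longrightarrow>
      m \<le> kemeny (chain_graph (\<lambda>_. H) T c) \<and>
      (star_graph T \<and> (\<forall>(i, j)\<in>parcs T. c i j = v) \<longrightarrow> kemeny (chain_graph (\<lambda>_. H) T c) = m)"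
    using kemeny_chain[OF assms(1-4)] by blast
  have S: "star_graph S" "tree_graph S" "pverts S = {1..k}" "chain_choice (\<lambda>_. H) S c"
    using opt by (auto simp: optimal_def star_graph_def)
  have "c i j = v" if "(i, j) \<in> parcs S" for i j
  proof -
    have "((i, c i j), (j, c j i)) \<in> chain_bridges S c" using that by (auto simp: chain_bridges_def)
    then show ?thesis using opt by (auto simp: optimal_def)
  qed
  then have "kemeny (chain_graph (\<lambda>_. H) S c) = m" using m[OF S(2-4)] S(1) by blast
  moreover have "m \<le> kemeny G" if "is_chain k (\<lambda>_. H) G" for G
    using that m unfolding is_chain_def by blast
  moreover have "is_chain k (\<lambda>_. H) (chain_graph (\<lambda>_. H) S c)"
    using S unfolding is_chain_def by blast
  ultimately show "is_arg_min kemeny (is_chain k (\<lambda>_. H)) (chain_graph (\<lambda>_. H) S c)"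
    by (auto simp: is_arg_min_def not_less)
qed

end
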